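(* Let $G = (V,E)$ be a directed graph and $s,t \in V$ such that $G$ contains an $s$-$t$-path. Let $E' := \{e \in E : e \text{ lies on an } s\text{-}t\text{-path or on a directed cycle in } G\}$. Then $S \subseteq E$ is identifying for $X^{\mathrm{flow}}_{G,s,t}$ if and only if the graph $(V, E'\setminus S)$ contains no undirected cycle.
   Context: $X^{\mathrm{flow}}_{G,s,t}$ is the set of all $s$-$t$-flows of value $1$ in $G$, i.e., all $x \in \mathbb{R}_+^E$ with $\sum_{e\in\delta^-(v)}x_e - \sum_{e\in\delta^+(v)}x_e = b_v$ for all $v\in V$, where $\delta^+(v)$, $\delta^-(v)$ are the arcs leaving/entering $v$ and $b_s=-1$, $b_t=1$, $b_v=0$ otherwise. A set $S \subseteq E$ is identifying for $X$ if for all $x, x' \in X$ with $x \neq x'$ there is $e \in S$ with $x_e \neq x'_e$. An undirected cycle is a cycle in the underlying undirected (multi)graph, ignoring arc directions. *)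

theory Defs
  imports Complex_Main "HOL-Library.FuncSet" "Graph_Theory.Graph_Theory"
begin

(* For s \<noteq> t this is b_s = -1, b_t = 1 and b_v = 0 otherwise. For s = t, where those
   prescriptions conflict, a unit enters and leaves at the same vertex, giving b = 0. *)
definition flow_balance :: "'a \<Rightarrow> 'a \<Rightarrow> 'a \<Rightarrow> real" where
  "flow_balance s t v = of_bool (v = t) - of_bool (v = s)"

(* Vectors indexed by the arc set are extensional functions, so that equality of functions
   is equality of vectors. *)
definition unit_flows :: "('a, 'b) pre_digraph \<Rightarrow> 'a \<Rightarrow> 'a \<Rightarrow> ('b \<Rightarrow> real) set" where
  "unit_flows G s t =
    {x \<in> arcs G \<rightarrow>\<^sub>E {0..}.
      \<forall>v \<in> verts G. (\<Sum>e \<in> in_arcs G v. x e) - (\<Sum>e \<in> out_arcs G v. x e) = flow_balance s t v}"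

definition identifying :: "'b set \<Rightarrow> ('b \<Rightarrow> real) set \<Rightarrow> bool" where
  "identifying S X \<longleftrightarrow> (\<forall>x \<in> X. \<forall>x' \<in> X. x \<noteq> x' \<longrightarrow> (\<exists>e \<in> S. x e \<noteq> x' e))"

definition path_or_cycle_arcs :: "('a, 'b) pre_digraph \<Rightarrow> 'a \<Rightarrow> 'a \<Rightarrow> 'b set" where
  "path_or_cycle_arcs G s t =
    {e \<in> arcs G. (\<exists>p. pre_digraph.apath G s p t \<and> e \<in> set p)
               \<or> (\<exists>p. pre_digraph.cycle G p \<and> e \<in> set p)}"

(* The cycle v_0 e_0 v_1 e_1 ... v_{k-1} e_{k-1} v_0 of the underlying undirected multigraph.
   A loop is a cycle of length 1, and two distinct (parallel or antiparallel) arcs between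
   the same two vertices form a cycle of length 2. *)
definition undirected_cycle :: "('a, 'b) pre_digraph \<Rightarrow> 'a list \<Rightarrow> 'b list \<Rightarrow> bool" where
  "undirected_cycle G vs es \<longleftrightarrow>
    es \<noteq> [] \<and> length vs = length es \<and> distinct vs \<and> distinct es \<and>
    set vs \<subseteq> verts G \<and> set es \<subseteq> arcs G \<and>
    (\<forall>i < length es. {tail G (es ! i), head G (es ! i)} = {vs ! i, vs ! (Suc i mod length es)})"

end

theory Submission
  imports Defs
begin

text \<open>
  A cut argument shows that an arc carrying positive flow lies on an \<open>s\<close>-\<open>t\<close>-path or on a directed
  cycle. Hence two flows that agree on \<open>S\<close> differ by a circulation supported in \<open>E' - S\<close>. In the
  support of a nonzero circulation no vertex is a leaf, so a longest path closes up to an undirected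
  cycle. Conversely, averaging suitable walks gives a unit flow that is positive on all of \<open>E'\<close>; it
  can be perturbed along an undirected cycle in \<open>E' - S\<close> without changing it on \<open>S\<close>.
\<close>

section \<open>Net inflow as a linear functional of arc weights\<close>

definition (in pre_digraph) net_inflow :: "('b \<Rightarrow> real) \<Rightarrow> 'a \<Rightarrow> real" where
  "net_inflow x v = (\<Sum>e\<in>arcs G. x e * flow_balance (tail G e) (head G e) v)"

lemma flow_balance_trans: "flow_balance u v a + flow_balance v w a = flow_balance u w a"
  by (simp add: flow_balance_def)

lemma sum_flow_balance:
  assumes "finite R"
  shows "(\<Sum>v\<in>R. flow_balance a b v) = of_bool (b \<in> R) - of_bool (a \<in> R)"
  using assms by (simp add: flow_balance_def sum_subtractf of_bool_def)

context fin_digraph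
begin

text \<open>Bridge to the two sums in \<open>unit_flows\<close>. In the single sum over all arcs
  each arc ships its weight from tail to head, so linearity is immediate and a loop contributes
  0.\<close>

lemma net_inflow_eq:
  "net_inflow x v = (\<Sum>e\<in>in_arcs G v. x e) - (\<Sum>e\<in>out_arcs G v. x e)"
proof -
  have "(\<Sum>e\<in>in_arcs G v. x e) = (\<Sum>e\<in>arcs G. x e * of_bool (v = head G e))"
    by (rule sum.mono_neutral_cong_left) auto
  moreover have "(\<Sum>e\<in>out_arcs G v. x e) = (\<Sum>e\<in>arcs G. x e * of_bool (v = tail G e))"
    by (rule sum.mono_neutral_cong_left) auto
  ultimately show ?thesis
    by (simp add: net_inflow_def flow_balance_def right_diff_distrib sum_subtractf)
qed

lemma unit_flows_iff:
  "x \<in> unit_flows G s t \<longleftrightarrow>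
    x \<in> arcs G \<rightarrow>\<^sub>E {0..} \<and> (\<forall>v\<in>verts G. net_inflow x v = flow_balance s t v)"
  by (simp add: unit_flows_def net_inflow_eq)

lemma net_inflow_cong:
  "(\<And>e. e \<in> arcs G \<Longrightarrow> x e = y e) \<Longrightarrow> net_inflow x v = net_inflow y v"
  by (simp add: net_inflow_def)

lemma net_inflow_add: "net_inflow (\<lambda>e. x e + y e) v = net_inflow x v + net_inflow y v"
  by (simp add: net_inflow_def distrib_right sum.distrib)

lemma net_inflow_diff: "net_inflow (\<lambda>e. x e - y e) v = net_inflow x v - net_inflow y v"
  by (simp add: net_inflow_def left_diff_distrib sum_subtractf)

lemma net_inflow_scale: "net_inflow (\<lambda>e. c * x e) v = c * net_inflow x v"
  by (simp add: net_inflow_def sum_distrib_left mult.assoc)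

lemma net_inflow_sum: "net_inflow (\<lambda>e. \<Sum>i\<in>I. x i e) v = (\<Sum>i\<in>I. net_inflow (x i) v)"
  unfolding net_inflow_def sum_distrib_right by (rule sum.swap)

lemma net_inflow_single:
  assumes "a \<in> arcs G"
  shows "net_inflow (\<lambda>e. of_bool (e = a)) v = flow_balance (tail G a) (head G a) v"
proof -
  have "net_inflow (\<lambda>e. of_bool (e = a)) v =
      (\<Sum>e\<in>arcs G. if e = a then flow_balance (tail G a) (head G a) v else 0)"
    unfolding net_inflow_def by (auto intro!: sum.cong)
  then show ?thesis
    using assms by simp
qed

text \<open>Cut formula: after swapping the sums, an arc counts positively if it enters
  \<open>R\<close>, negatively if it leaves \<open>R\<close>, and cancels otherwise.\<close>

lemma sum_net_inflow:
  assumes "finite R"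
  shows "(\<Sum>v\<in>R. net_inflow x v) =
    (\<Sum>e\<in>arcs G. x e * (of_bool (head G e \<in> R) - of_bool (tail G e \<in> R)))"
  unfolding net_inflow_def
  by (subst sum.swap) (simp add: assms sum_flow_balance flip: sum_distrib_left)

text \<open>Flows are built as total functions; this turns them into the extensional vectors of
  \<open>unit_flows\<close>.\<close>

lemma restrict_in_unit_flows:
  assumes "\<And>e. e \<in> arcs G \<Longrightarrow> 0 \<le> x e"
    and "\<And>v. v \<in> verts G \<Longrightarrow> net_inflow x v = flow_balance s t v"
  shows "restrict x (arcs G) \<in> unit_flows G s t"
proof -
  have "net_inflow (restrict x (arcs G)) v = net_inflow x v" for v
    by (rule net_inflow_cong) simp
  then show ?thesis
    using assms by (auto simp: unit_flows_iff)
qed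

text \<open>Inner vertices cancel by \<open>flow_balance_trans\<close>. For a closed walk the result
  is a circulation.\<close>

lemma net_inflow_awalk:
  assumes "awalk u p w"
  shows "net_inflow (\<lambda>e. real (count_list p e)) v = flow_balance u w v"
  using assms
proof (induction p arbitrary: u)
  case Nil
  then show ?case
    by (simp add: awalk_Nil_iff net_inflow_def flow_balance_def)
next
  case (Cons a p)
  then have a: "a \<in> arcs G" "tail G a = u" and "awalk (head G a) p w"
    by (auto simp: awalk_Cons_iff)
  have "(\<lambda>e. real (count_list (a # p) e)) = (\<lambda>e. of_bool (e = a) + real (count_list p e))"
    by auto
  then show ?case
    using Cons.IH[OF \<open>awalk (head G a) p w\<close>] a
    by (simp add: net_inflow_add net_inflow_single flow_balance_trans del: count_list.simps)
qed

subsection \<open>Arcs that can carry flow\<close>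

text \<open>A path through \<open>e\<close> is itself the flow. A cycle through \<open>e\<close>
  only gives a circulation, so the path \<open>p\<close> is added to supply the unit from
  \<open>s\<close> to \<open>t\<close>.\<close>

lemma arc_on_walk_flow:
  assumes "apath s p t" and "e \<in> path_or_cycle_arcs G s t"
  shows "\<exists>x. (\<forall>a. 0 \<le> x a) \<and> 0 < x e \<and> (\<forall>v. net_inflow x v = flow_balance s t v)"
proof -
  from assms(2) consider q where "apath s q t" "e \<in> set q" | q where "cycle q" "e \<in> set q"
    by (auto simp: path_or_cycle_arcs_def)
  then show ?thesis
  proof cases
    case 1
    moreover have "0 < count_list q e"
      using 1 by (metis count_list_0_iff gr0I)
    ultimately show ?thesis
      by (intro exI[of _ "\<lambda>a. real (count_list q a)"]) (auto dest: awalkI_apath simp: net_inflow_awalk)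
  next
    case 2
    then obtain u where "awalk u q u"
      by (auto simp: cycle_def)
    moreover have "awalk s p t"
      using assms(1) by (rule awalkI_apath)
    moreover have "0 < count_list q e"
      using 2 by (metis count_list_0_iff gr0I)
    ultimately show ?thesis
      by (intro exI[of _ "\<lambda>a. real (count_list p a) + real (count_list q a)"])
        (auto simp: net_inflow_add net_inflow_awalk flow_balance_def)
  qed
qed

lemma flow_positive_on_path_or_cycle_arcs:
  assumes "apath s p t"
  shows "\<exists>x. (\<forall>a. 0 \<le> x a) \<and> (\<forall>e\<in>path_or_cycle_arcs G s t. 0 < x e) \<and>
    (\<forall>v. net_inflow x v = flow_balance s t v)"
\<comment> \<open>An average over no flows is undefined; in that case positivity is vacuous and the
  path \<open>p\<close> suffices.\<close>
proof (cases "path_or_cycle_arcs G s t = {}")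
  case True
  then show ?thesis
    using net_inflow_awalk[OF awalkI_apath[OF assms]]
    by (intro exI[of _ "\<lambda>a. real (count_list p a)"]) simp
next
  case False
  define E where "E = path_or_cycle_arcs G s t"
  have E: "finite E" "E \<noteq> {}"
    using False finite_subset[OF _ finite_arcs, of E] by (auto simp: E_def path_or_cycle_arcs_def)
  obtain y where y: "\<And>f a. f \<in> E \<Longrightarrow> 0 \<le> y f a" "\<And>f. f \<in> E \<Longrightarrow> 0 < y f f"
    "\<And>f v. f \<in> E \<Longrightarrow> net_inflow (y f) v = flow_balance s t v"
    using arc_on_walk_flow[OF assms] unfolding E_def by metis
  \<comment> \<open>The average keeps the balance, and \<open>y e\<close> makes the summand for
    \<open>e\<close> positive at \<open>e\<close>.\<close>
  define x where "x a = inverse (real (card E)) * (\<Sum>f\<in>E. y f a)" for a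
  have card: "0 < real (card E)"
    using E by (simp add: card_gt_0_iff)
  have "0 \<le> x a" for a
    unfolding x_def by (intro mult_nonneg_nonneg sum_nonneg) (auto simp: y)
  moreover have "0 < x e" if "e \<in> E" for e
    unfolding x_def using card E that y by (intro mult_pos_pos sum_pos2[of _ e]) auto
  moreover have "net_inflow x v = flow_balance s t v" for v
    using card y(3) unfolding x_def by (simp add: net_inflow_scale net_inflow_sum)
  ultimately show ?thesis
    unfolding E_def by blast
qed

lemma positive_flow_arc:
  assumes x: "x \<in> unit_flows G s t" and e: "e \<in> arcs G" and pos: "0 < x e"
  shows "e \<in> path_or_cycle_arcs G s t"
proof (cases "head G e \<rightarrow>\<^sup>* tail G e")
  case True
  then obtain q where q: "apath (head G e) q (tail G e)"
    by (auto simp: reachable_apath)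
  \<comment> \<open>Apart from the first vertex, the vertices of \<open>e # q\<close> are those of
    the path \<open>q\<close>, hence distinct.\<close>
  then have "cycle (e # q)"
    using e unfolding cycle_def
    by (intro exI[of _ "tail G e"]) (auto simp: awalk_Cons_iff apath_def)
  then show ?thesis
    using e by (auto simp: path_or_cycle_arcs_def intro!: exI[of _ "e # q"])
next
  case False
  have nonneg: "0 \<le> x a" if "a \<in> arcs G" for a
    using x that by (auto simp: unit_flows_iff)
  have step: "tail G a \<rightarrow>\<^sup>* head G a" if "a \<in> arcs G" for a
    using that by (rule reachable_awalkI[OF arc_implies_awalk])
  \<comment> \<open>The right side is positive only if \<open>R\<close> contains \<open>t\<close>
    but not \<open>s\<close>, and negative only if it contains \<open>s\<close> but not
    \<open>t\<close>.\<close>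
  have cut: "(\<Sum>a\<in>arcs G. x a * (of_bool (head G a \<in> R) - of_bool (tail G a \<in> R)))
      = of_bool (t \<in> R) - of_bool (s \<in> R)" if "R \<subseteq> verts G" for R
  proof -
    have "finite R"
      using that finite_verts by (rule finite_subset)
    have "(\<Sum>v\<in>R. net_inflow x v) = (\<Sum>v\<in>R. flow_balance s t v)"
      using x that by (intro sum.cong) (auto simp: unit_flows_iff)
    then show ?thesis
      using \<open>finite R\<close> by (simp add: sum_net_inflow sum_flow_balance)
  qed
  have ends: "head G e \<in> verts G" "tail G e \<in> verts G"
    using e by auto
  \<comment> \<open>No arc leaves the set reachable from the head of \<open>e\<close>, while \<open>e\<close> itself enters it
    with positive flow; so the sink must lie inside. Dually for the source.\<close>
  have "head G e \<rightarrow>\<^sup>* t"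
  proof -
    define R where "R = {w. head G e \<rightarrow>\<^sup>* w}"
    have "R \<subseteq> verts G"
      by (auto simp: R_def reachable_in_verts)
    moreover have "0 < (\<Sum>a\<in>arcs G. x a * (of_bool (head G a \<in> R) - of_bool (tail G a \<in> R)))"
    proof (rule sum_pos2[of _ e])
      show "0 < x e * (of_bool (head G e \<in> R) - of_bool (tail G e \<in> R))"
        using pos False ends by (simp add: R_def)
      show "0 \<le> x a * (of_bool (head G a \<in> R) - of_bool (tail G a \<in> R))" if "a \<in> arcs G" for a
        using nonneg[OF that] step[OF that] reachable_trans[of "head G e" "tail G a" "head G a"]
        by (auto simp: R_def)
    qed (use e in auto)
    ultimately show ?thesis
      using cut[of R] by (auto simp: R_def of_bool_def split: if_splits)
  qed
  then obtain q where q: "apath (head G e) q t"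
    by (auto simp: reachable_apath)
  have "s \<rightarrow>\<^sup>* tail G e"
  proof -
    define R where "R = {w. w \<rightarrow>\<^sup>* tail G e}"
    have "R \<subseteq> verts G"
      by (auto simp: R_def reachable_in_verts)
    moreover have "0 < (\<Sum>a\<in>arcs G. - (x a * (of_bool (head G a \<in> R) - of_bool (tail G a \<in> R))))"
    proof (rule sum_pos2[of _ e])
      show "0 < - (x e * (of_bool (head G e \<in> R) - of_bool (tail G e \<in> R)))"
        using pos False ends by (simp add: R_def)
      show "0 \<le> - (x a * (of_bool (head G a \<in> R) - of_bool (tail G a \<in> R)))" if "a \<in> arcs G" for a
        using nonneg[OF that] step[OF that] reachable_trans[of "tail G a" "head G a" "tail G e"]
        by (auto simp: R_def)
    qed (use e in auto)
    ultimately show ?thesis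
      using cut[of R] by (auto simp: R_def of_bool_def sum_negf split: if_splits)
  qed
  then obtain p where p: "apath s p (tail G e)"
    by (auto simp: reachable_apath)
  then have last: "awlast s p = tail G e"
    by (auto simp: apath_def)
  \<comment> \<open>A common vertex would make \<open>tail G e\<close> reachable from
    \<open>head G e\<close>, contrary to the case assumption.\<close>
  have disjoint: "w \<notin> set (awalk_verts (head G e) q)" if "w \<in> set (awalk_verts s p)" for w
    using False that p q awalk_verts_reachable_to awalk_verts_reachable_from reachable_trans
    by (meson awalkI_apath)
  moreover have "tail G e \<in> set (awalk_verts s p)"
    using last by (metis awalk_verts_non_Nil last_in_set)
  ultimately have "apath s (p @ e # q) t"
    using p q e last by (auto simp: apath_append_iff apath_Cons_iff)
  then show ?thesis
    using e by (auto simp: path_or_cycle_arcs_def intro!: exI[of _ "p @ e # q"])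
qed

subsection \<open>Circulations and undirected cycles\<close>

text \<open>Send one unit around the cycle, with sign -1 on arcs traversed against their
  direction.\<close>

lemma undirected_cycle_circulation:
  assumes "undirected_cycle G vs es"
  shows "\<exists>c. (\<forall>v. net_inflow c v = 0) \<and> (\<forall>e. e \<notin> set es \<longrightarrow> c e = 0) \<and> (\<forall>e\<in>set es. \<bar>c e\<bar> = 1)"
proof -
  define k where "k = length es"
  have k: "0 < k" and arcs: "\<And>i. i < k \<Longrightarrow> es ! i \<in> arcs G" and "distinct es"
    and ends: "\<And>i. i < k \<Longrightarrow> {tail G (es ! i), head G (es ! i)} = {vs ! i, vs ! (Suc i mod k)}"
    using assms by (auto simp: undirected_cycle_def k_def)
  define d where "d i = (if tail G (es ! i) = vs ! i then 1 else - 1 :: real)" for i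
  \<comment> \<open>As a sum of indicators, \<open>c\<close> is covered by the linearity lemmas;
    since \<open>es\<close> is distinct, exactly one summand is nonzero on each cycle arc.\<close>
  define c where "c e = (\<Sum>i<k. d i * of_bool (e = es ! i))" for e
  have d: "d i * flow_balance (tail G (es ! i)) (head G (es ! i)) v
      = flow_balance (vs ! i) (vs ! (Suc i mod k)) v" if "i < k" for i v
    using ends[OF that] by (auto simp: d_def flow_balance_def doubleton_eq_iff)
  \<comment> \<open>Cyclic shift of the indices: only the last one wraps around, to 0. It makes the
    balances around the cycle cancel.\<close>
  have "(\<Sum>i<k. f (Suc i mod k)) = (\<Sum>i<k. f i)" for f :: "nat \<Rightarrow> real"
  proof -
    obtain m where m: "k = Suc m"
      using k by (cases k) auto
    have "(\<Sum>i<k. f (Suc i mod k)) = (\<Sum>i<m. f (Suc i)) + f 0"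
      by (simp add: m)
    then show ?thesis
      by (simp add: m sum.lessThan_Suc_shift del: sum.lessThan_Suc)
  qed
  note rotate = this[of "\<lambda>i. of_bool (v = vs ! i)" for v]
  have "net_inflow c v = 0" for v
  proof -
    have "net_inflow c v = (\<Sum>i<k. d i * flow_balance (tail G (es ! i)) (head G (es ! i)) v)"
      unfolding c_def using arcs by (simp add: net_inflow_sum net_inflow_scale net_inflow_single del: sum_mult_of_bool_eq)
    also have "\<dots> = (\<Sum>i<k. flow_balance (vs ! i) (vs ! (Suc i mod k)) v)"
      using d by simp
    also have "\<dots> = 0"
      using rotate[of v] by (simp add: flow_balance_def sum_subtractf)
    finally show ?thesis .
  qed
  moreover have "c e = 0" if "e \<notin> set es" for e
    unfolding c_def using that by (intro sum.neutral) (auto simp: k_def)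
  moreover have "\<bar>c e\<bar> = 1" if e: "e \<in> set es" for e
  proof -
    obtain j where j: "j < k" "e = es ! j"
      using e by (auto simp: in_set_conv_nth k_def)
    have "c e = (\<Sum>i<k. if i = j then d i else 0)"
      unfolding c_def using j \<open>distinct es\<close>
      by (intro sum.cong) (auto simp: k_def nth_eq_iff_index_eq)
    then show ?thesis
      using j by (simp add: d_def)
  qed
  ultimately show ?thesis
    by blast
qed

text \<open>If \<open>e\<close> were the only arc at \<open>v\<close> with nonzero value, the net
  inflow would be \<open>d e\<close> or \<open>- d e\<close>, because \<open>e\<close> is not a
  loop.\<close>

lemma circulation_second_arc:
  assumes "net_inflow d v = 0" and e: "e \<in> arcs G" "d e \<noteq> 0" "tail G e \<noteq> head G e"
    and v: "v \<in> {tail G e, head G e}"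
  shows "\<exists>f\<in>arcs G. f \<noteq> e \<and> d f \<noteq> 0 \<and> v \<in> {tail G f, head G f}"
proof (rule ccontr)
  assume "\<not> ?thesis"
  then have "net_inflow d v = (\<Sum>f\<in>arcs G. if f = e then d e * flow_balance (tail G e) (head G e) v else 0)"
    unfolding net_inflow_def by (intro sum.cong) (auto simp: flow_balance_def)
  also have "\<dots> \<noteq> 0"
    using e v by (auto simp: flow_balance_def)
  finally show False
    using assms(1) by simp
qed

text \<open>A loop in the support is already a cycle. Otherwise a second support arc
  \<open>f\<close> at the first vertex of a longest path must lead back to the path, and closes an
  initial segment of it.\<close>

lemma undirected_cycle_in_circulation:
  assumes d: "\<And>v. v \<in> verts G \<Longrightarrow> net_inflow d v = 0" and e: "e \<in> arcs G" "d e \<noteq> 0"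
  shows "\<exists>vs es. undirected_cycle (G\<lparr>arcs := {a \<in> arcs G. d a \<noteq> 0}\<rparr>) vs es"
proof (cases "\<exists>a\<in>arcs G. d a \<noteq> 0 \<and> tail G a = head G a")
  case True
  then obtain a where "a \<in> arcs G" "d a \<noteq> 0" "tail G a = head G a"
    by blast
  then have "undirected_cycle (G\<lparr>arcs := {a \<in> arcs G. d a \<noteq> 0}\<rparr>) [tail G a] [a]"
    by (auto simp: undirected_cycle_def)
  then show ?thesis
    by blast
next
  case False
  define F where "F = {a \<in> arcs G. d a \<noteq> 0}"
  \<comment> \<open>Paths in the support, ignoring directions. Distinctness of \<open>es\<close> is
    derived below from that of \<open>vs\<close>.\<close>
  define path where "path vs es \<longleftrightarrow> length vs = Suc (length es) \<and> distinct vs \<and> set vs \<subseteq> verts G \<and>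
    set es \<subseteq> F \<and> es \<noteq> [] \<and>
    (\<forall>i<length es. {tail G (es ! i), head G (es ! i)} = {vs ! i, vs ! Suc i})" for vs es
  have "path [tail G e, head G e] [e]"
    using e False by (auto simp: path_def F_def)
  \<comment> \<open>This bound ensures that a longest path exists.\<close>
  moreover have "length es < card (verts G)" if "path vs es" for vs es
  proof -
    have "length vs = card (set vs)"
      using that by (simp add: path_def distinct_card)
    also have "\<dots> \<le> card (verts G)"
      using that by (intro card_mono) (auto simp: path_def)
    finally show ?thesis
      using that by (simp add: path_def)
  qed
  ultimately obtain es where "\<exists>vs. path vs es"
    and max: "\<And>vs' es'. path vs' es' \<Longrightarrow> length es' \<le> length es"
    using ex_has_greatest_nat[of "\<lambda>es. \<exists>vs. path vs es" "[e]" length "card (verts G)"]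
    by (metis less_imp_le)
  then obtain vs where path: "path vs es"
    by blast
  then have len: "length vs = Suc (length es)" and dist: "distinct vs" and vs: "set vs \<subseteq> verts G"
    and es: "set es \<subseteq> F" "es \<noteq> []"
    and ends: "\<And>i. i < length es \<Longrightarrow> {tail G (es ! i), head G (es ! i)} = {vs ! i, vs ! Suc i}"
    by (auto simp: path_def)
  have "es ! 0 \<in> F" "vs ! 0 \<in> {tail G (es ! 0), head G (es ! 0)}" "vs ! 0 \<in> verts G"
    using es ends[of 0] vs len by auto
  then obtain f where f: "f \<in> F" "f \<noteq> es ! 0" "vs ! 0 \<in> {tail G f, head G f}"
    using circulation_second_arc[of d "vs ! 0" "es ! 0"] d False by (auto simp: F_def)
  \<comment> \<open>The end of \<open>f\<close> other than \<open>vs ! 0\<close>; the support has no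
    loops here.\<close>
  define w where "w = (if vs ! 0 = tail G f then head G f else tail G f)"
  have w: "{tail G f, head G f} = {vs ! 0, w}" "w \<in> verts G" "w \<noteq> vs ! 0"
    using f False by (auto simp: F_def w_def)
  have "w \<in> set vs"
  proof (rule ccontr)
    assume "w \<notin> set vs"
    then have "path (w # vs) (f # es)"
      using path w f(1) by (auto simp: path_def nth_Cons' insert_commute)
    then show False
      using max by fastforce
  qed
  then obtain j where j: "j < length vs" "w = vs ! j"
    by (auto simp: in_set_conv_nth)
  have j0: "0 < j"
    using w j by (cases j) auto
  \<comment> \<open>A path arc meets only its two consecutive path vertices. Hence path arcs are
    distinct, and only \<open>es ! 0\<close> among them meets \<open>vs ! 0\<close>, so
    \<open>f\<close> is a new arc.\<close>
  have in_arc: "vs ! i \<in> {tail G (es ! l), head G (es ! l)} \<longleftrightarrow> i = l \<or> i = Suc l"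
    if "l < length es" "i < length vs" for i l
    using that dist len by (auto simp: ends nth_eq_iff_index_eq)
  have "distinct es"
    unfolding distinct_conv_nth
  proof (intro allI impI)
    fix i l assume il: "i < length es" "l < length es" "i \<noteq> l"
    show "es ! i \<noteq> es ! l"
    proof
      assume eq: "es ! i = es ! l"
      have "i = l \<or> i = Suc l"
        using in_arc[of i i] in_arc[of l i] il len eq by simp
      moreover have "l = i \<or> l = Suc i"
        using in_arc[of l l] in_arc[of i l] il len eq by simp
      ultimately show False
        using il by auto
    qed
  qed
  moreover have "f \<notin> set es"
  proof
    assume "f \<in> set es"
    then obtain i where i: "i < length es" "f = es ! i"
      by (auto simp: in_set_conv_nth)
    then have "i = 0"
      using in_arc[of i 0] f(3) len by auto
    then show False
      using f(2) i by simp
  qed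
  ultimately have "distinct (take j es @ [f])"
    by (auto dest: in_set_takeD)
  \<comment> \<open>At \<open>i = j\<close> the index wraps to 0: the closing arc \<open>f\<close>
    joins \<open>vs ! j = w\<close> to \<open>vs ! 0\<close>.\<close>
  moreover have "{tail G ((take j es @ [f]) ! i), head G ((take j es @ [f]) ! i)}
      = {take (Suc j) vs ! i, take (Suc j) vs ! (Suc i mod Suc j)}" if "i < Suc j" for i
  proof (cases "i = j")
    case True
    then show ?thesis
      using w j j0 len by (simp add: nth_append insert_commute)
  next
    case False
    then show ?thesis
      using that ends[of i] j len by (simp add: nth_append)
  qed
  ultimately have "undirected_cycle (G\<lparr>arcs := F\<rparr>) (take (Suc j) vs) (take j es @ [f])"
    using j len dist vs es f(1) unfolding undirected_cycle_def
    by (auto dest: in_set_takeD)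
  then show ?thesis
    unfolding F_def by blast
qed

end

section \<open>The two implications: perturbing one flow, comparing two flows\<close>

lemma undirected_cycle_mono:
  assumes "undirected_cycle (G\<lparr>arcs := A\<rparr>) vs es" and "A \<subseteq> B"
  shows "undirected_cycle (G\<lparr>arcs := B\<rparr>) vs es"
  using assms by (auto simp: undirected_cycle_def)

theorem theorem4p1:
  fixes G :: "('a, 'b) pre_digraph" and s t :: 'a and S :: "'b set"
  assumes "fin_digraph G"
    and "s \<in> verts G" and "t \<in> verts G"
    and "\<exists>p. pre_digraph.apath G s p t"
    and "S \<subseteq> arcs G"
  shows "identifying S (unit_flows G s t) \<longleftrightarrow>
    \<not> (\<exists>vs es. undirected_cycle (G\<lparr>arcs := path_or_cycle_arcs G s t - S\<rparr>) vs es)"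
proof -
  interpret fin_digraph G
    by fact
  let ?E = "path_or_cycle_arcs G s t"
  have E: "?E \<subseteq> arcs G"
    by (auto simp: path_or_cycle_arcs_def)
  have "\<not> identifying S (unit_flows G s t)" if "undirected_cycle (G\<lparr>arcs := ?E - S\<rparr>) vs es" for vs es
  proof -
    have es: "set es \<subseteq> ?E - S" "es \<noteq> []"
      using that by (auto simp: undirected_cycle_def)
    have "undirected_cycle G vs es"
      using undirected_cycle_mono[OF that, of "arcs G"] E by auto
    then obtain c where c: "\<And>v. net_inflow c v = 0" "\<And>e. e \<notin> set es \<Longrightarrow> c e = 0"
      "\<And>e. e \<in> set es \<Longrightarrow> \<bar>c e\<bar> = 1"
      using undirected_cycle_circulation by metis
    obtain x where x: "\<And>a. 0 \<le> x a" "\<And>e. e \<in> ?E \<Longrightarrow> 0 < x e"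
      "\<And>v. net_inflow x v = flow_balance s t v"
      using assms(4) flow_positive_on_path_or_cycle_arcs by metis
    \<comment> \<open>The least flow on the cycle. As \<open>c\<close> has absolute value 1 there,
      adding \<open>r * c\<close> keeps the flow nonnegative.\<close>
    define r where "r = Min (x ` set es)"
    have "0 < r"
      unfolding r_def using es x(2) by (subst Min_gr_iff) auto
    have r: "r \<le> x e" if "e \<in> set es" for e
      unfolding r_def using that by simp
    define y where "y e = x e + r * c e" for e
    have "0 \<le> y e" for e
      using r[of e] c(2)[of e] c(3)[of e] x(1)[of e] \<open>0 < r\<close>
      by (cases "e \<in> set es") (auto simp: y_def abs_if split: if_splits)
    moreover have "net_inflow y v = flow_balance s t v" for v
      unfolding y_def by (simp add: net_inflow_add net_inflow_scale x c)
    ultimately have "restrict y (arcs G) \<in> unit_flows G s t"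
      by (intro restrict_in_unit_flows)
    moreover have "restrict x (arcs G) \<in> unit_flows G s t"
      using x by (intro restrict_in_unit_flows)
    moreover have "restrict x (arcs G) \<noteq> restrict y (arcs G)"
    proof
      assume eq: "restrict x (arcs G) = restrict y (arcs G)"
      have "hd es \<in> set es" "hd es \<in> arcs G"
        using es E hd_in_set[of es] by blast+
      then have "x (hd es) = y (hd es)"
        using fun_cong[OF eq, of "hd es"] by simp
      then show False
        using c(3)[OF \<open>hd es \<in> set es\<close>] \<open>0 < r\<close> by (simp add: y_def)
    qed
    \<comment> \<open>The cycle avoids \<open>S\<close>, so \<open>c\<close> vanishes on
      \<open>S\<close>.\<close>
    moreover have "restrict x (arcs G) e = restrict y (arcs G) e" if "e \<in> S" for e
      using c(2)[of e] es that by (auto simp: y_def restrict_def)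
    ultimately show ?thesis
      unfolding identifying_def by blast
  qed
  moreover have "\<exists>vs es. undirected_cycle (G\<lparr>arcs := ?E - S\<rparr>) vs es"
    if not_id: "\<not> identifying S (unit_flows G s t)"
  proof -
    obtain x y where x: "x \<in> unit_flows G s t" and y: "y \<in> unit_flows G s t" and "x \<noteq> y"
      and S: "\<And>e. e \<in> S \<Longrightarrow> x e = y e"
      using not_id by (auto simp: identifying_def)
    define d where "d e = x e - y e" for e
    have "\<exists>e\<in>arcs G. x e \<noteq> y e"
      using x y \<open>x \<noteq> y\<close> PiE_ext[of x "arcs G" "\<lambda>_. {0..}" y] by (auto simp: unit_flows_iff)
    then obtain e where "e \<in> arcs G" "d e \<noteq> 0"
      by (auto simp: d_def)
    moreover have "net_inflow d v = 0" if "v \<in> verts G" for v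
      unfolding d_def using x y that by (simp add: net_inflow_diff unit_flows_iff)
    ultimately obtain vs es where "undirected_cycle (G\<lparr>arcs := {a \<in> arcs G. d a \<noteq> 0}\<rparr>) vs es"
      using undirected_cycle_in_circulation by blast
    \<comment> \<open>Where two nonnegative flows differ, one is positive, so
      \<open>positive_flow_arc\<close> applies; on \<open>S\<close> they agree.\<close>
    moreover have "{a \<in> arcs G. d a \<noteq> 0} \<subseteq> ?E - S"
    proof
      fix a assume a: "a \<in> {a \<in> arcs G. d a \<noteq> 0}"
      then have "0 \<le> x a" "0 \<le> y a" "x a \<noteq> y a"
        using x y by (auto simp: unit_flows_iff d_def)
      then have "0 < x a \<or> 0 < y a"
        by linarith
      then show "a \<in> ?E - S"
        using a S positive_flow_arc[OF x] positive_flow_arc[OF y] by (auto simp: d_def)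
    qed
    ultimately show ?thesis
      using undirected_cycle_mono by blast
  qed
  ultimately show ?thesis
    by blast
qed

end
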